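(* For every positive integer $k$, $$RR(x+y+kz=2w) = \begin{cases} \frac{k(k+4)}{4}+1 & \text{if } k\equiv 0 \pmod 4,\\ \frac{(k+2)(k+3)}{4}+1 & \text{if } k\equiv 1 \pmod 4,\\ \frac{(k+2)^2}{4}+1 & \text{if } k\equiv 2 \pmod 4,\\ \frac{(k+1)(k+4)}{4}+1 & \text{if } k\equiv 3 \pmod 4.\end{cases}$$
   Context: A $2$-coloring of $[1,N]=\{1,2,\dots,N\}$ is a map $\chi:[1,N]\to\{0,1\}$; a solution $(x,y,z,w)$ with $x,y,z,w\in[1,N]$ (not necessarily distinct) is monochromatic if $\chi(x)=\chi(y)=\chi(z)=\chi(w)$. For an equation $\mathcal{E}$ in the variables $x,y,z,w$, $RR(\mathcal{E})$ denotes the minimum positive integer $N$ such that every $2$-coloring of $[1,N]$ admits a monochromatic solution to $\mathcal{E}$ in $[1,N]$. *)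

theory Defs
  imports Main "HOL-Library.FuncSet" "HOL-Library.Extended_Nat"
begin

definition is_2_coloring :: "nat \<Rightarrow> (nat \<Rightarrow> nat) \<Rightarrow> bool" where
  "is_2_coloring N \<chi> \<longleftrightarrow> \<chi> \<in> {1..N} \<rightarrow> {0, 1}"

text \<open>An equation in four unknowns is represented by the predicate that holds of
  \<open>x y z w\<close> exactly when they satisfy it.\<close>

definition has_mono_solution ::
  "(nat \<Rightarrow> nat \<Rightarrow> nat \<Rightarrow> nat \<Rightarrow> bool) \<Rightarrow> nat \<Rightarrow> (nat \<Rightarrow> nat) \<Rightarrow> bool" where
  "has_mono_solution E N \<chi> \<longleftrightarrow>
     (\<exists>x\<in>{1..N}. \<exists>y\<in>{1..N}. \<exists>z\<in>{1..N}. \<exists>w\<in>{1..N}.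
        E x y z w \<and> \<chi> x = \<chi> y \<and> \<chi> y = \<chi> z \<and> \<chi> z = \<chi> w)"

text \<open>The infimum in \<^typ>\<open>enat\<close> of a nonempty set is its minimum, and that of the empty set is
  \<open>\<infinity>\<close>. Hence \<open>RR E = enat n\<close> includes the claim that a suitable \<open>N\<close> exists.\<close>

definition RR :: "(nat \<Rightarrow> nat \<Rightarrow> nat \<Rightarrow> nat \<Rightarrow> bool) \<Rightarrow> enat" where
  "RR E = Inf {enat N | N. N > 0 \<and> (\<forall>\<chi>. is_2_coloring N \<chi> \<longrightarrow> has_mono_solution E N \<chi>)}"

end

theory Submission
  imports Defs
begin

text \<open>Lower bounds: give the numbers below \<open>(k + 2) / 2\<close> one color and the others the other. For
  \<open>k mod 4 \<in> {1, 2}\<close> one further number \<open>p\<close> fits: put it into the first class, where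
  \<open>x + k * z = p\<close> has no solution because the residue of \<open>p\<close> modulo \<open>k\<close> is too large.

  Upper bounds: starting from the color of \<open>1\<close> (and, for odd \<open>k\<close>, of \<open>2\<close>), each suitable
  solution in which all but one number have the same known color forces the color of the remaining
  one, and a short chain of such steps ends in a contradiction. The chains were read off from
  computer searches for small \<open>k\<close>.\<close>

text \<open>An avoiding coloring restricts to every shorter interval, so a single one on
  \<open>{1..N - 1}\<close> rules out all candidates below \<open>N\<close>.\<close>

lemma RR_eqI:
  assumes "N > 0"
    and forced: "\<And>\<chi>. is_2_coloring N \<chi> \<Longrightarrow> has_mono_solution E N \<chi>"
    and avoiding: "is_2_coloring (N - 1) \<chi>" "\<not> has_mono_solution E (N - 1) \<chi>"
  shows "RR E = enat N"
  unfolding RR_def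
proof (rule antisym)
  show "Inf {enat N |N. N > 0 \<and> (\<forall>\<chi>. is_2_coloring N \<chi> \<longrightarrow> has_mono_solution E N \<chi>)} \<le> enat N"
    using assms(1) forced by (intro Inf_lower) auto
next
  have "N \<le> M" if M: "\<And>\<chi>. is_2_coloring M \<chi> \<Longrightarrow> has_mono_solution E M \<chi>" for M
  proof (rule ccontr)
    assume "\<not> N \<le> M"
    then have sub: "{1..M} \<subseteq> {1..N - 1}" by auto
    with avoiding(1) have "is_2_coloring M \<chi>"
      unfolding is_2_coloring_def by blast
    then have "has_mono_solution E M \<chi>" by (rule M)
    with sub have "has_mono_solution E (N - 1) \<chi>"
      unfolding has_mono_solution_def by blast
    with avoiding(2) show False ..
  qed
  then show "enat N \<le> Inf {enat N |N. N > 0 \<and> (\<forall>\<chi>. is_2_coloring N \<chi> \<longrightarrow> has_mono_solution E N \<chi>)}"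
    by (intro Inf_greatest) auto
qed

section \<open>Upper bounds by forcing chains\<close>

locale solution_free =
  fixes k N :: nat and c :: "nat \<Rightarrow> bool"
  assumes no_solution: "\<lbrakk>x + y + k * z = 2 * w; x \<in> {1..N}; y \<in> {1..N}; z \<in> {1..N}; w \<in> {1..N}\<rbrakk>
    \<Longrightarrow> \<not> (c x = c y \<and> c y = c z \<and> c z = c w)"
begin

lemma bound_0:
  assumes k: "k = 4 * j" and c1: "c 1"
  shows "N < 4 * j * j + 4 * j + 1"
proof (rule ccontr)
  assume N: "\<not> ?thesis"
  note solve = k algebra_simps
  have a: "\<not> c (2 * j + 1)"
    using no_solution[of 1 1 1 "2 * j + 1"] N c1 by (auto simp: solve)
  have b: "c (4 * j * j + 4 * j + 1)"
    using a no_solution[of "2 * j + 1" "2 * j + 1" "2 * j + 1" "4 * j * j + 4 * j + 1"] N c1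
    by (auto simp: solve)
  have d: "\<not> c (2 * j * j + 4 * j + 1)"
    using b no_solution[of "4 * j * j + 4 * j + 1" 1 1 "2 * j * j + 4 * j + 1"] N c1
    by (auto simp: solve)
  \<comment> \<open>For \<open>y = w\<close> the equation reduces to \<open>x + k * z = w\<close>;
    here \<open>1 + k * (j + 1) = (2 * j + 1)^2\<close>.\<close>
  have e: "\<not> c (j + 1)"
    using b no_solution[of 1 "4 * j * j + 4 * j + 1" "j + 1" "4 * j * j + 4 * j + 1"] N c1
    by (auto simp: solve)
  show False
    using a d e no_solution[of "2 * j + 1" "2 * j + 1" "j + 1" "2 * j * j + 4 * j + 1"] N c1
    by (auto simp: solve)
qed

lemma bound_2:
  assumes k: "k = 4 * j + 2" and c1: "c 1"
  shows "N < 4 * j * j + 8 * j + 5"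
proof (rule ccontr)
  assume N: "\<not> ?thesis"
  \<comment> \<open>This is \<open>k * (j + 1) + 2 * j + 2\<close>, the end of the interval colored
    in \<open>RR_1_2\<close>.\<close>
  define p where "p = 4 * j * j + 8 * j + 4"
  note solve = k p_def algebra_simps
  have a: "\<not> c (2 * j + 2)"
    using no_solution[of 1 1 1 "2 * j + 2"] N c1 by (auto simp: solve)
  have p: "c p"
    using a no_solution[of "2 * j + 2" "2 * j + 2" "2 * j + 2" p] N c1 by (auto simp: solve)
  have b: "\<not> c (4 * j * j + 6 * j + 3)"
    using p no_solution[of "4 * j * j + 6 * j + 3" "4 * j * j + 6 * j + 3" 1 p] N c1
    by (auto simp: solve)
  have d: "c (2 * j + 1)"
    using a b no_solution[of "2 * j + 2" "2 * j + 2" "2 * j + 1" "4 * j * j + 6 * j + 3"] N c1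
    by (auto simp: solve)
  have e: "\<not> c (2 * j + 3)"
    using p no_solution[of 1 1 "2 * j + 3" p] N c1 by (auto simp: solve)
  \<comment> \<open>An avoiding coloring of \<open>{1..p}\<close> exists, so the chain has to pass
    through \<open>p + 1\<close>.\<close>
  have q: "c (p + 1)"
    using a e no_solution[of "2 * j + 3" "2 * j + 3" "2 * j + 2" "p + 1"] N c1 by (auto simp: solve)
  have f: "\<not> c (j + 1)"
    using p q d no_solution[of "p + 1" "2 * j + 1" "j + 1" p] N c1 by (auto simp: solve)
  have g: "\<not> c (4 * j * j + 4 * j + 2)"
    using d no_solution[of 1 1 "2 * j + 1" "4 * j * j + 4 * j + 2"] N c1 by (auto simp: solve)
  show False
    using a b f g
      no_solution[of "4 * j * j + 4 * j + 2" "2 * j + 2" "j + 1" "4 * j * j + 6 * j + 3"] N c1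
    by (auto simp: solve)
qed

text \<open>For odd \<open>k\<close> the sum \<open>1 + 1 + k\<close> is odd, so the color of
  \<open>1\<close> alone forces nothing through \<open>x = y = z = 1\<close>. Knowing the color of
  \<open>2\<close> as well allows parity to be corrected.\<close>

lemma two_same_color:
  assumes "2 * k + 2 \<le> N" "c 1"
  shows "c 2"
proof (rule ccontr)
  assume two: "\<not> c 2"
  have "c (k + 2)"
    using two no_solution[of 2 2 2 "k + 2"] assms by (auto simp: algebra_simps)
  moreover have "c (2 * k + 2)"
    using two no_solution[of 2 "2 * k + 2" 2 "2 * k + 2"] assms by (auto simp: algebra_simps)
  ultimately show False
    using no_solution[of "k + 2" "2 * k + 2" 1 "2 * k + 2"] assms by (auto simp: algebra_simps)
qed

lemma bound_1:
  assumes k: "k = 4 * j + 1" and c1: "c 1"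
  shows "N < 4 * j * j + 7 * j + 4"
proof (rule ccontr)
  assume N: "\<not> ?thesis"
  define p where "p = 4 * j * j + 7 * j + 3"
  have "j \<le> 4 * j * j" by simp
  with N k have "2 * k + 2 \<le> N" by linarith
  then have c2: "c 2" using c1 by (rule two_same_color)
  note solve = k p_def algebra_simps
  have "j \<noteq> 0"
  proof
    assume "j = 0"
    with no_solution[of 1 1 2 2] N c1 c2 show False by (auto simp: solve)
  qed
  have a: "\<not> c (2 * j + 2)"
    using no_solution[of 1 2 1 "2 * j + 2"] N c1 c2 by (auto simp: solve)
  have p: "c p"
    using a no_solution[of "2 * j + 2" "2 * j + 2" "2 * j + 2" p] N c1 c2 by (auto simp: solve)
  have b: "\<not> c (2 * j + 3)"
    using p no_solution[of 1 2 "2 * j + 3" p] N c1 c2 by (auto simp: solve)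
  have q: "c (p + 1)"
    using a b no_solution[of "2 * j + 3" "2 * j + 3" "2 * j + 2" "p + 1"] N c1 c2 by (auto simp: solve)
  have d1: "\<not> c (k + 1)"
    using no_solution[of 1 "k + 1" 1 "k + 1"] N c1 c2 by (auto simp: solve)
  have d2: "\<not> c (k + 2)"
    using no_solution[of 2 "k + 2" 1 "k + 2"] N c1 c2 \<open>j \<noteq> 0\<close> by (auto simp: solve)
  \<comment> \<open>Since \<open>p = k * (j + 1) + 2 * j + 2\<close>, replacing \<open>p\<close>,
    \<open>i\<close>, \<open>1\<close> by \<open>k + i\<close>, \<open>2 * j + 2\<close>,
    \<open>j + 1\<close> keeps the sum, hence \<open>w\<close>. The first triple forces
    \<open>w\<close>, the second then \<open>j + 1\<close>. The parity of \<open>j\<close> decides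
    between \<open>i = 2\<close> and \<open>i = 1\<close>.\<close>
  have e: "c (j + 1)"
  proof (cases "even j")
    case True
    then have "even (p + k + 2)" by (simp add: p_def k)
    then obtain w where w: "p + k + 2 = 2 * w" by (rule evenE)
    have "k + 2 \<le> p" using \<open>j \<noteq> 0\<close> by (simp add: p_def k)
    then have w_le: "w \<le> N" "1 \<le> w" using w N c1 c2 by (simp_all add: p_def)
    have "\<not> c w"
      using p c1 c2 w w_le no_solution[of p 2 1 w] N c1 c2 by (auto simp: p_def)
    moreover have "(k + 2) + (2 * j + 2) + k * (j + 1) = 2 * w"
      using w by (simp add: solve)
    ultimately show ?thesis
      using a d2 w_le no_solution[of "k + 2" "2 * j + 2" "j + 1" w] N c1 c2 \<open>k + 2 \<le> p\<close>
      by (auto simp: p_def)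
  next
    case False
    then have "even (p + k + 1)" by (simp add: p_def k)
    then obtain w where w: "p + k + 1 = 2 * w" by (rule evenE)
    have "k + 2 \<le> p" using \<open>j \<noteq> 0\<close> by (simp add: p_def k)
    then have w_le: "w \<le> N" "1 \<le> w" using w N c1 c2 by (simp_all add: p_def)
    have "\<not> c w"
      using p c1 w w_le no_solution[of p 1 1 w] N c1 c2 by (auto simp: p_def)
    moreover have "(k + 1) + (2 * j + 2) + k * (j + 1) = 2 * w"
      using w by (simp add: solve)
    ultimately show ?thesis
      using a d1 w_le no_solution[of "k + 1" "2 * j + 2" "j + 1" w] N c1 c2 \<open>k + 2 \<le> p\<close>
      by (auto simp: p_def)
  qed
  have f: "\<not> c (4 * j * j + 5 * j + 2)"
    using e no_solution[of 1 "4 * j * j + 5 * j + 2" "j + 1" "4 * j * j + 5 * j + 2"] N c1 c2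
    by (auto simp: solve)
  have g: "c (2 * j + 1)"
    using a f no_solution[of "2 * j + 1" "2 * j + 2" "2 * j + 1" "4 * j * j + 5 * j + 2"] N c1 c2
    by (auto simp: solve)
  show False
    using e g p q no_solution[of "p + 1" "2 * j + 1" "j + 1" p] N c1 c2 by (auto simp: solve)
qed

lemma bound_3:
  assumes k: "k = 4 * j + 3" and c1: "c 1"
  shows "N < 4 * j * j + 11 * j + 8"
proof (rule ccontr)
  assume N: "\<not> ?thesis"
  define p where "p = 4 * j * j + 11 * j + 8"
  have "4 * j \<le> 4 * j * j" by simp
  with N k have k2: "2 * k + 2 \<le> N" by linarith
  then have c2: "c 2" using c1 by (rule two_same_color)
  note solve = k p_def algebra_simps
  have a1: "\<not> c (k + 1)"
    using no_solution[of 1 "k + 1" 1 "k + 1"] k2 c1 by auto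
  have a2: "\<not> c (k + 2)"
    using no_solution[of 2 "k + 2" 1 "k + 2"] k2 c1 c2 by auto
  have a3: "\<not> c (2 * k + 2)"
    using no_solution[of 2 "2 * k + 2" 2 "2 * k + 2"] k2 c2 by auto
  \<comment> \<open>The color of \<open>3\<close> is needed to reach \<open>2 * j + 4\<close>: as
    \<open>(k + 2) * (2 * j + 3)\<close> is odd, \<open>2 * j + 3\<close> alone cannot force
    \<open>p\<close>.\<close>
  have c3: "c 3"
    using a1 a3 no_solution[of 3 "k + 1" 3 "2 * k + 2"] k2 k by (auto simp: algebra_simps)
  have "j > 0"
  proof (rule gr0I)
    assume "j = 0"
    with no_solution[of 1 2 1 3] N c1 c2 c3 show False by (auto simp: solve)
  qed
  have b1: "\<not> c (2 * j + 3)"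
    using no_solution[of 1 2 1 "2 * j + 3"] N c1 c2 by (auto simp: solve)
  have b2: "\<not> c (2 * j + 4)"
    using c3 no_solution[of 2 3 1 "2 * j + 4"] N c1 c2 by (auto simp: solve)
  have p: "c p"
    using b1 b2 no_solution[of "2 * j + 3" "2 * j + 4" "2 * j + 3" p] N c1 c2 by (auto simp: solve)
  have d: "\<not> c (j + 2)"
    using p no_solution[of 2 p "j + 2" p] N c1 c2 by (auto simp: solve)
  \<comment> \<open>This keeps the number \<open>w\<close> below within \<open>{1..p}\<close>. It
    fails for \<open>j = 0\<close>, which was therefore settled separately.\<close>
  have "3 * k + 2 \<le> p" using \<open>j > 0\<close> unfolding p_def k by (cases j) simp_all
  show False
  \<comment> \<open>Here \<open>p = k * (j + 2) + 2\<close>, so the triples \<open>p\<close>,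
    \<open>i\<close>, \<open>3\<close> and \<open>k + i\<close>, \<open>2 * k + 2\<close>,
    \<open>j + 2\<close> have equal sums. They force opposite colors on the same \<open>w\<close>;
    parity selects \<open>i\<close>.\<close>
  proof (cases "even j")
    case True
    then have "even (p + 3 * k + 1)" by (simp add: p_def k)
    then obtain w where w: "p + 3 * k + 1 = 2 * w" by (rule evenE)
    then have w_le: "w \<le> N" "1 \<le> w" using N \<open>3 * k + 2 \<le> p\<close> by (simp_all add: p_def)
    have "\<not> c w"
      using p c1 c3 w w_le no_solution[of p 1 3 w] N c1 c2 by (auto simp: p_def)
    moreover have "(k + 1) + (2 * k + 2) + k * (j + 2) = 2 * w"
      using w by (simp add: solve)
    ultimately show ?thesis
      using a1 a3 d w_le no_solution[of "k + 1" "2 * k + 2" "j + 2" w] k2 k by auto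
  next
    case False
    then have "even (p + 3 * k + 2)" by (simp add: p_def k)
    then obtain w where w: "p + 3 * k + 2 = 2 * w" by (rule evenE)
    then have w_le: "w \<le> N" "1 \<le> w" using N \<open>3 * k + 2 \<le> p\<close> by (simp_all add: p_def)
    have "\<not> c w"
      using p c2 c3 w w_le no_solution[of p 2 3 w] N c1 c2 by (auto simp: p_def)
    moreover have "(k + 2) + (2 * k + 2) + k * (j + 2) = 2 * w"
      using w by (simp add: solve)
    ultimately show ?thesis
      using a2 a3 d w_le no_solution[of "k + 2" "2 * k + 2" "j + 2" w] k2 k by auto
  qed
qed

end

text \<open>With two colors, agreeing with \<open>1\<close> or not determines the color. This choice
  of predicate makes the assumption \<open>c 1\<close> of the bounds automatic.\<close>

lemma solution_free_of_coloring:
  assumes "is_2_coloring N \<chi>" "N > 0"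
    and "\<not> has_mono_solution (\<lambda>x y z w. x + y + k * z = 2 * w) N \<chi>"
  shows "solution_free k N (\<lambda>i. \<chi> i = \<chi> 1)"
proof
  fix x y z w
  assume sol: "x + y + k * z = 2 * w"
    and mem: "x \<in> {1..N}" "y \<in> {1..N}" "z \<in> {1..N}" "w \<in> {1..N}"
  have col: "\<chi> i = 0 \<or> \<chi> i = 1" if "i \<in> {1..N}" for i
    using assms(1) that unfolding is_2_coloring_def by blast
  have "\<not> (\<chi> x = \<chi> y \<and> \<chi> y = \<chi> z \<and> \<chi> z = \<chi> w)"
    using assms(3) sol mem unfolding has_mono_solution_def by blast
  moreover have "\<chi> 1 = 0 \<or> \<chi> 1 = 1" using \<open>N > 0\<close> by (intro col) simp
  ultimately show "\<not> ((\<chi> x = \<chi> 1) = (\<chi> y = \<chi> 1) \<and> (\<chi> y = \<chi> 1) = (\<chi> z = \<chi> 1) \<and>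
      (\<chi> z = \<chi> 1) = (\<chi> w = \<chi> 1))"
    using mem[THEN col] by auto
qed

section \<open>Lower bounds by explicit colorings\<close>

lemma RR_eq_by_class:
  fixes A :: "nat set"
  assumes bound: "\<And>N c. solution_free k N c \<Longrightarrow> c 1 \<Longrightarrow> N < M + 1"
    and inside: "\<And>x y z w. \<lbrakk>x + y + k * z = 2 * w; x \<in> A \<inter> {1..M}; y \<in> A \<inter> {1..M};
      z \<in> A \<inter> {1..M}; w \<in> A \<inter> {1..M}\<rbrakk> \<Longrightarrow> False"
    and outside: "\<And>x y z w. \<lbrakk>x + y + k * z = 2 * w; x \<in> {1..M} - A; y \<in> {1..M} - A;
      z \<in> {1..M} - A; w \<in> {1..M} - A\<rbrakk> \<Longrightarrow> False"
  shows "RR (\<lambda>x y z w. x + y + k * z = 2 * w) = enat (M + 1)"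
proof (rule RR_eqI)
  fix \<chi>
  assume "is_2_coloring (M + 1) \<chi>"
  then show "has_mono_solution (\<lambda>x y z w. x + y + k * z = 2 * w) (M + 1) \<chi>"
    using bound[OF solution_free_of_coloring] by fastforce
next
  let ?\<chi> = "\<lambda>i. if i \<in> A then 0 else 1 :: nat"
  show "is_2_coloring (M + 1 - 1) ?\<chi>" by (simp add: is_2_coloring_def)
  show "\<not> has_mono_solution (\<lambda>x y z w. x + y + k * z = 2 * w) (M + 1 - 1) ?\<chi>"
    unfolding has_mono_solution_def add_diff_cancel_right'
  proof (intro notI, elim bexE conjE)
    fix x y z w
    assume mem: "x \<in> {1..M}" "y \<in> {1..M}" "z \<in> {1..M}" "w \<in> {1..M}"
      and sol: "x + y + k * z = 2 * w" and "?\<chi> x = ?\<chi> y" "?\<chi> y = ?\<chi> z" "?\<chi> z = ?\<chi> w"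
    then have "y \<in> A \<longleftrightarrow> x \<in> A" "z \<in> A \<longleftrightarrow> x \<in> A" "w \<in> A \<longleftrightarrow> x \<in> A"
      by (metis zero_neq_one)+
    then show False
      using inside[OF sol] outside[OF sol] mem by blast
  qed
qed simp

text \<open>The coefficients sum to \<open>k + 2\<close>, so in a class with least element
  \<open>m\<close> every solution has \<open>2 * w\<close> at least \<open>(k + 2) * m\<close>. This
  pushes \<open>w\<close> beyond the class.\<close>

lemma sum_ge:
  fixes x y z :: nat
  assumes "m \<le> x" "m \<le> y" "m \<le> z"
  shows "(k + 2) * m \<le> x + y + k * z"
proof -
  have "k * m \<le> k * z" using assms(3) by (rule mult_le_mono2)
  then show ?thesis using assms unfolding distrib_right by linarith
qed

lemma RR_0:
  assumes k: "k = 4 * j"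
  shows "RR (\<lambda>x y z w. x + y + k * z = 2 * w) = enat (4 * j * j + 4 * j + 1)"
proof (rule RR_eq_by_class[where A = "{..2 * j}"])
  fix x y z w
  assume "x + y + k * z = 2 * w" "x \<in> {..2 * j} \<inter> {1..4 * j * j + 4 * j}"
    "y \<in> {..2 * j} \<inter> {1..4 * j * j + 4 * j}" "z \<in> {..2 * j} \<inter> {1..4 * j * j + 4 * j}"
    "w \<in> {..2 * j} \<inter> {1..4 * j * j + 4 * j}"
  then show False using sum_ge[of 1 x y z k] by (auto simp: k)
next
  fix x y z w
  assume "x + y + k * z = 2 * w" "x \<in> {1..4 * j * j + 4 * j} - {..2 * j}"
    "y \<in> {1..4 * j * j + 4 * j} - {..2 * j}" "z \<in> {1..4 * j * j + 4 * j} - {..2 * j}"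
    "w \<in> {1..4 * j * j + 4 * j} - {..2 * j}"
  then show False using sum_ge[of "2 * j + 1" x y z k] by (auto simp: k algebra_simps)
qed (rule solution_free.bound_0[OF _ k])

lemma RR_3:
  assumes k: "k = 4 * j + 3"
  shows "RR (\<lambda>x y z w. x + y + k * z = 2 * w) = enat (4 * j * j + 11 * j + 7 + 1)"
proof (rule RR_eq_by_class[where A = "{..2 * j + 2}"])
  fix x y z w
  let ?I = "{1..4 * j * j + 11 * j + 7}"
  assume "x + y + k * z = 2 * w" "x \<in> {..2 * j + 2} \<inter> ?I" "y \<in> {..2 * j + 2} \<inter> ?I"
    "z \<in> {..2 * j + 2} \<inter> ?I" "w \<in> {..2 * j + 2} \<inter> ?I"
  then show False using sum_ge[of 1 x y z k] by (auto simp: k)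
next
  fix x y z w
  let ?I = "{1..4 * j * j + 11 * j + 7}"
  assume "x + y + k * z = 2 * w" "x \<in> ?I - {..2 * j + 2}" "y \<in> ?I - {..2 * j + 2}"
    "z \<in> ?I - {..2 * j + 2}" "w \<in> ?I - {..2 * j + 2}"
  \<comment> \<open>The bound \<open>(4 * j + 5) * (2 * j + 3)\<close> exceeds twice the right end
    of \<open>?I\<close> by exactly one.\<close>
  then show False using sum_ge[of "2 * j + 3" x y z k] by (auto simp: k algebra_simps)
qed (use solution_free.bound_3[OF _ k] in force)

text \<open>A solution would have \<open>w = p\<close>, and exactly one of \<open>x\<close> and \<open>y\<close> equal to \<open>p\<close>. The other one
  would then be congruent to \<open>2 * j + 2\<close> modulo \<open>k\<close>.\<close>

lemma no_solution_small_or_last: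
  fixes k j p :: nat
  assumes p: "p = k * (j + 1) + 2 * j + 2"
    and k: "4 * j + 1 \<le> k"
    and sol: "x + y + k * z = 2 * w"
    and mem: "x \<in> {1..2 * j + 1} \<union> {p}" "y \<in> {1..2 * j + 1} \<union> {p}"
      "z \<in> {1..2 * j + 1} \<union> {p}" "w \<in> {1..2 * j + 1} \<union> {p}"
  shows False
proof -
  have pos: "1 \<le> x" "1 \<le> y" "1 \<le> z" using mem p by auto
  have w: "w = p"
    using sum_ge[OF pos, of k] mem(4) k sol by auto
  \<comment> \<open>Cancelling one \<open>p\<close> against \<open>w = p\<close> leaves
    \<open>u + k * z = p\<close>. For \<open>z\<close> up to \<open>j + 1\<close>, \<open>u\<close>
    falls strictly between \<open>2 * j + 1\<close> and \<open>p\<close>; for larger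
    \<open>z\<close> it would be below \<open>1\<close>.\<close>
  have one_last: False
    if u: "u + k * z = p" "u \<in> {1..2 * j + 1} \<union> {p}" and z: "z \<in> {1..2 * j + 1}" for u
  proof (cases "z \<le> j + 1")
    case True
    then have "k * z \<le> k * (j + 1)" by (rule mult_le_mono2)
    moreover have "k * z > 0" using z k by simp
    ultimately show ?thesis using u p by auto
  next
    case False
    then have "k * (j + 2) \<le> k * z" by (intro mult_le_mono2) simp
    moreover have "j > 0" using False z by simp
    ultimately show ?thesis using u k p pos by (auto simp: algebra_simps)
  qed
  show False
  proof (cases "z = p")
    case True
    show ?thesis
    proof (cases "k \<ge> 2")
      case True
      then have "2 * p \<le> k * p" by simp
      with \<open>z = p\<close> w sol pos show ?thesis by simp
    next
      case False
      then have "k = 1" "j = 0" using k by auto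
      with \<open>z = p\<close> w sol mem p show ?thesis by auto
    qed
  next
    case False
    then have z: "z \<in> {1..2 * j + 1}" using mem by blast
    \<comment> \<open>If all three were small, the sum would be at most
      \<open>(k + 2) * (2 * j + 1)\<close>, less than
      \<open>2 * p = (k + 2) * (2 * j + 2)\<close>.\<close>
    then have "k * z \<le> k * (2 * j + 1)" by (intro mult_le_mono2) simp
    then have "\<not> (x \<le> 2 * j + 1 \<and> y \<le> 2 * j + 1)"
      using sol w p k by (auto simp: algebra_simps)
    then have "x = p \<or> y = p" using mem by auto
    then show ?thesis
      using one_last[of y] one_last[of x] sol w mem z by auto
  qed
qed

lemma RR_1_2:
  assumes k: "k = 4 * j + 1 \<or> k = 4 * j + 2"
  shows "RR (\<lambda>x y z w. x + y + k * z = 2 * w) = enat (k * (j + 1) + 2 * j + 2 + 1)"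
proof (rule RR_eq_by_class[where A = "{..2 * j + 1} \<union> {k * (j + 1) + 2 * j + 2}"])
  fix N c
  assume "solution_free k N c" "c 1"
  then show "N < k * (j + 1) + 2 * j + 2 + 1"
    using solution_free.bound_1[of k N c j] solution_free.bound_2[of k N c j] k
    by (auto simp: algebra_simps)
next
  fix x y z w
  let ?p = "k * (j + 1) + 2 * j + 2"
  let ?C = "({..2 * j + 1} \<union> {?p}) \<inter> {1..?p}"
  assume sol: "x + y + k * z = 2 * w" "x \<in> ?C" "y \<in> ?C" "z \<in> ?C" "w \<in> ?C"
  show False
    by (rule no_solution_small_or_last[OF refl _ sol(1)]) (use k sol(2-) in auto)
next
  fix x y z w
  let ?p = "k * (j + 1) + 2 * j + 2"
  let ?C = "{1..?p} - ({..2 * j + 1} \<union> {?p})"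
  assume "x + y + k * z = 2 * w" "x \<in> ?C" "y \<in> ?C" "z \<in> ?C" "w \<in> ?C"
  \<comment> \<open>The bound is \<open>(k + 2) * (2 * j + 2) = 2 * ?p\<close>, so \<open>w\<close>
    would be at least \<open>?p\<close>: moving this one number to the other class suffices.\<close>
  then show False
    using sum_ge[of "2 * j + 2" x y z k] k by (auto simp: algebra_simps)
qed

theorem theorem8:
  fixes k :: nat
  assumes "k > 0"
  shows "RR (\<lambda>x y z w. x + y + k * z = 2 * w) = enat (
    if k mod 4 = 0 then k * (k + 4) div 4 + 1
    else if k mod 4 = 1 then (k + 2) * (k + 3) div 4 + 1
    else if k mod 4 = 2 then (k + 2)^2 div 4 + 1
    else (k + 1) * (k + 4) div 4 + 1)"
proof -
  define j where "j = k div 4"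
  have k: "k = 4 * j + k mod 4" by (simp add: j_def)
  \<comment> \<open>Each numerator is a multiple of 4 in its residue class, so \<open>div\<close>
    agrees with the exact quotient.\<close>
  have div4: "n div 4 = m" if "n = 4 * m" for m n :: nat using that by simp
  have "k mod 4 < 4" by simp
  then consider "k mod 4 = 0" | "k mod 4 = 1" | "k mod 4 = 2" | "k mod 4 = 3" by linarith
  then show ?thesis
  proof cases
    case 1
    with k have "k = 4 * j" by simp
    moreover from this have "k * (k + 4) div 4 = 4 * j * j + 4 * j"
      by (intro div4) (simp add: algebra_simps)
    ultimately show ?thesis using 1 RR_0[of k j] by simp
  next
    case 2
    with k have "k = 4 * j + 1" by simp
    moreover from this have "(k + 2) * (k + 3) div 4 = k * (j + 1) + 2 * j + 2"
      by (intro div4) (simp add: algebra_simps)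
    ultimately show ?thesis using 2 RR_1_2[of k j] by simp
  next
    case 3
    with k have "k = 4 * j + 2" by simp
    moreover from this have "(k + 2)^2 div 4 = k * (j + 1) + 2 * j + 2"
      by (intro div4) (simp add: power2_eq_square algebra_simps)
    ultimately show ?thesis using 3 RR_1_2[of k j] by simp
  next
    case 4
    with k have "k = 4 * j + 3" by simp
    moreover from this have "(k + 1) * (k + 4) div 4 = 4 * j * j + 11 * j + 7"
      by (intro div4) (simp add: algebra_simps)
    ultimately show ?thesis using 4 RR_3[of k j] by simp
  qed
qed

end
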